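(* Let $(\mathbf{A},\mathbf{B})$ be a promise template over finite domains such that $\operatorname{Pol}(\mathbf{A},\mathbf{B})$ contains block-symmetric polymorphisms of arbitrarily large width (i.e. for every $N$ there is a polymorphism of width at least $N$). Then the BLP+Affine algorithm correctly solves $\operatorname{PCSP-Decision}(\mathbf{A},\mathbf{B})$: it accepts every instance satisfiable in $\mathbf{A}$ and rejects every instance not satisfiable in $\mathbf{B}$.
   Context: A signature $\tau$ is a set of symbols $R$, each with a positive integer arity $\operatorname{ar}(R)$. A relational structure $\mathbf{A}$ with signature $\tau$ consists of a finite domain $A$ and relations $R^{\mathbf{A}}\subseteq A^{\operatorname{ar}(R)}$ for $R\in\tau$. A homomorphism $\mathbf{A}\to\mathbf{B}$ is a map $\sigma:A\to B$ with $\sigma(R^{\mathbf{A}})\subseteq R^{\mathbf{B}}$ for all $R\in\tau$ (componentwise). A promise template $(\mathbf{A},\mathbf{B})$ is a pair of such structures with the same signature such that a homomorphism $\mathbf{A}\to\mathbf{B}$ exists. An instance $\mathbf{X}$ consists of variables $x_1,\dots,x_n$ and constraints $c_j=(R_j,\bar x^j)$, $j\in[m]$, with $R_j\in\tau$ and $\bar x^j$ a tuple of variables of length $\operatorname{ar}(R_j)$. $\mathbf{X}$ is satisfiable in $\mathbf{C}$ if some assignment $\sigma$ of values in $C$ to variables has $\sigma(\bar x^j)\in R_j^{\mathbf{C}}$ for all $j$. $\operatorname{PCSP-Decision}(\mathbf{A},\mathbf{B})$: distinguish instances satisfiable in $\mathbf{A}$ from instances not satisfiable in $\mathbf{B}$.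 A polymorphism of $(\mathbf{A},\mathbf{B})$ of arity $L$ is a map $f:A^L\to B$ such that for every $R\in\tau$ and all $x^{(1)},\dots,x^{(L)}\in R^{\mathbf{A}}$, the tuple obtained by applying $f$ coordinatewise, $(f(x^{(1)}_t,\dots,x^{(L)}_t))_{t=1}^{\operatorname{ar}(R)}$, lies in $R^{\mathbf{B}}$. $\operatorname{Pol}(\mathbf{A},\mathbf{B})$ is the set of all polymorphisms. A map $f:A^L\to B$ is block-symmetric with respect to a partition $[L]=B_1\cup\dots\cup B_k$ if $f$ is invariant under every permutation of coordinates that maps each block $B_i$ to itself. The width of $f$ is the maximum, over all partitions with respect to which $f$ is block-symmetric, of the minimum block size. Basic LP $\operatorname{LP}_{\mathbb{Q}}(\mathbf{X},\mathbf{A})$: rational variables $w_i(a)$ ($i\in[n],a\in A$), $p_j(y)$ ($j\in[m]$, $y\in R_j^{\mathbf{A}}$) with $w_i(a)\ge0$, $p_j(y)\ge0$, $\sum_a w_i(a)=1$, $\sum_{y}p_j(y)=1$, and $\sum_{y\in R_j^{\mathbf{A}},\,y|_i=a}p_j(y)=w_i(a)$ for all $i,a,j$ with $x_i$ occurring in $\bar x^j$ ($y|_i=a$ meaning the coordinate of $y$ at the position of $x_i$ in $\bar x^j$ is $a$). Affine relaxation $\operatorname{Aff}_{\mathbb{Z}}(\mathbf{X},\mathbf{A})$: integer variables $r_i(a)$, $q_j(y)$ satisfying the same equalities (no nonnegativity). BLP+Affine algorithm: (1) If $\operatorname{LP}_{\mathbb{Q}}(\mathbf{X},\mathbf{A})$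 is infeasible, reject; otherwise take a relative interior point $(w,p)$ (a feasible point where each coordinate is positive iff it is positive at some feasible point). (2) Form $\operatorname{Aff}'_{\mathbb{Z}}(\mathbf{X},\mathbf{A})$ by adding to $\operatorname{Aff}_{\mathbb{Z}}(\mathbf{X},\mathbf{A})$ the constraints $r_i(a)=0$ whenever $w_i(a)=0$ and $q_j(y)=0$ whenever $p_j(y)=0$. (3) If $\operatorname{Aff}'_{\mathbb{Z}}(\mathbf{X},\mathbf{A})$ has no integer solution, reject; else accept. It correctly solves $\operatorname{PCSP-Decision}(\mathbf{A},\mathbf{B})$ if it accepts every instance satisfiable in $\mathbf{A}$ and rejects every instance not satisfiable in $\mathbf{B}$. *)

theory Defs
  imports Complex_Main "HOL-Library.FuncSet" "HOL-Library.Disjoint_Sets"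
    "HOL-Combinatorics.Permutations"
begin

section \<open>Promise templates\<close>

record 'r signature =
  symbols :: "'r set"
  arity :: "'r \<Rightarrow> nat"

definition is_signature :: "'r signature \<Rightarrow> bool" where
  "is_signature \<tau> \<longleftrightarrow> (\<forall>R\<in>symbols \<tau>. 0 < arity \<tau> R)"

definition tuples :: "nat \<Rightarrow> 'a set \<Rightarrow> 'a list set" where
  "tuples k S = {xs. length xs = k \<and> set xs \<subseteq> S}"

record ('r, 'a) rel_structure =
  domain :: "'a set"
  relation :: "'r \<Rightarrow> 'a list set"

definition is_structure :: "'r signature \<Rightarrow> ('r, 'a) rel_structure \<Rightarrow> bool" where
  "is_structure \<tau> A \<longleftrightarrow> finite (domain A) \<and>
     (\<forall>R\<in>symbols \<tau>. relation A R \<subseteq> tuples (arity \<tau> R) (domain A))"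

definition is_hom ::
  "'r signature \<Rightarrow> ('r, 'a) rel_structure \<Rightarrow> ('r, 'b) rel_structure \<Rightarrow> ('a \<Rightarrow> 'b) \<Rightarrow> bool" where
  "is_hom \<tau> A B \<sigma> \<longleftrightarrow> \<sigma> \<in> domain A \<rightarrow> domain B \<and>
     (\<forall>R\<in>symbols \<tau>. map \<sigma> ` relation A R \<subseteq> relation B R)"

definition promise_template ::
  "'r signature \<Rightarrow> ('r, 'a) rel_structure \<Rightarrow> ('r, 'b) rel_structure \<Rightarrow> bool" where
  "promise_template \<tau> A B \<longleftrightarrow>
     is_signature \<tau> \<and> is_structure \<tau> A \<and> is_structure \<tau> B \<and> (\<exists>\<sigma>. is_hom \<tau> A B \<sigma>)"

section \<open>Instances\<close>

text \<open>The variables are the indices \<open>0, \<dots>, nvars X - 1\<close>; a variable may occur several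
  times in the same constraint.\<close>

record 'r pcsp_instance =
  nvars :: nat
  constraints :: "('r \<times> nat list) list"

definition is_instance :: "'r signature \<Rightarrow> 'r pcsp_instance \<Rightarrow> bool" where
  "is_instance \<tau> X \<longleftrightarrow>
     (\<forall>(R, xs)\<in>set (constraints X). R \<in> symbols \<tau> \<and> xs \<in> tuples (arity \<tau> R) {..<nvars X})"

definition satisfiable_in :: "'r pcsp_instance \<Rightarrow> ('r, 'c) rel_structure \<Rightarrow> bool" where
  "satisfiable_in X C \<longleftrightarrow>
     (\<exists>\<sigma>. \<sigma> \<in> {..<nvars X} \<rightarrow> domain C \<and>
          (\<forall>(R, xs)\<in>set (constraints X). map \<sigma> xs \<in> relation C R))"

section \<open>Polymorphisms and block symmetry\<close>

text \<open>Only the values of \<open>f\<close> on \<open>tuples L (domain A)\<close> matter. The arity \<open>L\<close> is positive.\<close>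

definition is_polymorphism ::
  "'r signature \<Rightarrow> ('r, 'a) rel_structure \<Rightarrow> ('r, 'b) rel_structure \<Rightarrow> nat \<Rightarrow> ('a list \<Rightarrow> 'b) \<Rightarrow> bool"
where
  "is_polymorphism \<tau> A B L f \<longleftrightarrow> 0 < L \<and> f \<in> tuples L (domain A) \<rightarrow> domain B \<and>
     (\<forall>R\<in>symbols \<tau>. \<forall>x :: nat \<Rightarrow> 'a list. (\<forall>l<L. x l \<in> relation A R) \<longrightarrow>
        map (\<lambda>t. f (map (\<lambda>l. x l ! t) [0..<L])) [0..<arity \<tau> R] \<in> relation B R)"

definition Pol ::
  "'r signature \<Rightarrow> ('r, 'a) rel_structure \<Rightarrow> ('r, 'b) rel_structure \<Rightarrow> (nat \<times> ('a list \<Rightarrow> 'b)) set"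
where
  "Pol \<tau> A B = {(L, f). is_polymorphism \<tau> A B L f}"

definition block_symmetric :: "'a set \<Rightarrow> nat \<Rightarrow> ('a list \<Rightarrow> 'b) \<Rightarrow> nat set set \<Rightarrow> bool" where
  "block_symmetric S L f P \<longleftrightarrow>
     (\<forall>\<pi>. \<pi> permutes {..<L} \<longrightarrow> (\<forall>D\<in>P. \<pi> ` D = D) \<longrightarrow>
        (\<forall>xs\<in>tuples L S. f (permute_list \<pi> xs) = f xs))"

text \<open>For \<open>0 < L\<close> the partition into singletons is always admissible and all partitions are
  nonempty, so that \<open>Max\<close> and \<open>Min\<close> are taken over finite nonempty sets.\<close>

definition width :: "'a set \<Rightarrow> nat \<Rightarrow> ('a list \<Rightarrow> 'b) \<Rightarrow> nat" where
  "width S L f =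
     Max ((\<lambda>P. Min (card ` P)) ` {P. partition_on {..<L} P \<and> block_symmetric S L f P})"

section \<open>The basic LP and the affine relaxation\<close>

text \<open>The equalities common to both relaxations. The marginal condition is imposed for every
  position \<open>t\<close> of every constraint, hence at each occurrence of a repeated variable.\<close>

definition relaxation_equalities ::
  "'r pcsp_instance \<Rightarrow> ('r, 'a) rel_structure \<Rightarrow>
   (nat \<Rightarrow> 'a \<Rightarrow> 'n::comm_ring_1) \<Rightarrow> (nat \<Rightarrow> 'a list \<Rightarrow> 'n) \<Rightarrow> bool" where
  "relaxation_equalities X A w p \<longleftrightarrow>
     (\<forall>i<nvars X. (\<Sum>a\<in>domain A. w i a) = 1) \<and>
     (\<forall>j<length (constraints X). case constraints X ! j of (R, xs) \<Rightarrow>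
        (\<Sum>y\<in>relation A R. p j y) = 1 \<and>
        (\<forall>t<length xs. \<forall>a\<in>domain A. (\<Sum>y\<in>{y \<in> relation A R. y ! t = a}. p j y) = w (xs ! t) a))"

definition LP_feasible ::
  "'r pcsp_instance \<Rightarrow> ('r, 'a) rel_structure \<Rightarrow> (nat \<Rightarrow> 'a \<Rightarrow> rat) \<Rightarrow> (nat \<Rightarrow> 'a list \<Rightarrow> rat) \<Rightarrow> bool"
where
  "LP_feasible X A w p \<longleftrightarrow> relaxation_equalities X A w p \<and>
     (\<forall>i<nvars X. \<forall>a\<in>domain A. 0 \<le> w i a) \<and>
     (\<forall>j<length (constraints X). \<forall>y\<in>relation A (fst (constraints X ! j)). 0 \<le> p j y)"

definition LP_relative_interior ::
  "'r pcsp_instance \<Rightarrow> ('r, 'a) rel_structure \<Rightarrow> (nat \<Rightarrow> 'a \<Rightarrow> rat) \<Rightarrow> (nat \<Rightarrow> 'a list \<Rightarrow> rat) \<Rightarrow> bool"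
where
  "LP_relative_interior X A w p \<longleftrightarrow> LP_feasible X A w p \<and>
     (\<forall>i<nvars X. \<forall>a\<in>domain A.
        0 < w i a \<longleftrightarrow> (\<exists>w' p'. LP_feasible X A w' p' \<and> 0 < w' i a)) \<and>
     (\<forall>j<length (constraints X). \<forall>y\<in>relation A (fst (constraints X ! j)).
        0 < p j y \<longleftrightarrow> (\<exists>w' p'. LP_feasible X A w' p' \<and> 0 < p' j y))"

definition Aff_solution ::
  "'r pcsp_instance \<Rightarrow> ('r, 'a) rel_structure \<Rightarrow> (nat \<Rightarrow> 'a \<Rightarrow> int) \<Rightarrow> (nat \<Rightarrow> 'a list \<Rightarrow> int) \<Rightarrow> bool"
where
  "Aff_solution X A r q \<longleftrightarrow> relaxation_equalities X A r q"

definition refined_Aff_solution ::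
  "'r pcsp_instance \<Rightarrow> ('r, 'a) rel_structure \<Rightarrow>
   (nat \<Rightarrow> 'a \<Rightarrow> rat) \<Rightarrow> (nat \<Rightarrow> 'a list \<Rightarrow> rat) \<Rightarrow>
   (nat \<Rightarrow> 'a \<Rightarrow> int) \<Rightarrow> (nat \<Rightarrow> 'a list \<Rightarrow> int) \<Rightarrow> bool" where
  "refined_Aff_solution X A w p r q \<longleftrightarrow> Aff_solution X A r q \<and>
     (\<forall>i<nvars X. \<forall>a\<in>domain A. w i a = 0 \<longrightarrow> r i a = 0) \<and>
     (\<forall>j<length (constraints X). \<forall>y\<in>relation A (fst (constraints X ! j)).
        p j y = 0 \<longrightarrow> q j y = 0)"

section \<open>The BLP+Affine algorithm\<close>

text \<open>The algorithm is nondeterministic in the choice of the relative interior point;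
  \<open>BLP_Affine_run A X v\<close> says that some run on \<open>X\<close> ends with verdict \<open>v\<close>.\<close>

datatype verdict = Accept | Reject

inductive BLP_Affine_run :: "('r, 'a) rel_structure \<Rightarrow> 'r pcsp_instance \<Rightarrow> verdict \<Rightarrow> bool"
  for A :: "('r, 'a) rel_structure" and X :: "'r pcsp_instance" where
  reject_LP: "(\<nexists>w p. LP_feasible X A w p) \<Longrightarrow> BLP_Affine_run A X Reject"
| reject_Aff: "LP_relative_interior X A w p \<Longrightarrow> (\<nexists>r q. refined_Aff_solution X A w p r q) \<Longrightarrow>
    BLP_Affine_run A X Reject"
| accept: "LP_relative_interior X A w p \<Longrightarrow> refined_Aff_solution X A w p r q \<Longrightarrow>
    BLP_Affine_run A X Accept"

text \<open>Equality with a singleton says that a run exists (that is, step 1 never gets stuck for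
  lack of a relative interior point) and that every run returns the given verdict.\<close>

definition BLP_Affine_accepts :: "('r, 'a) rel_structure \<Rightarrow> 'r pcsp_instance \<Rightarrow> bool" where
  "BLP_Affine_accepts A X \<longleftrightarrow> {v. BLP_Affine_run A X v} = {Accept}"

definition BLP_Affine_rejects :: "('r, 'a) rel_structure \<Rightarrow> 'r pcsp_instance \<Rightarrow> bool" where
  "BLP_Affine_rejects A X \<longleftrightarrow> {v. BLP_Affine_run A X v} = {Reject}"

definition BLP_Affine_solves_PCSP_Decision ::
  "'r signature \<Rightarrow> ('r, 'a) rel_structure \<Rightarrow> ('r, 'b) rel_structure \<Rightarrow> bool" where
  "BLP_Affine_solves_PCSP_Decision \<tau> A B \<longleftrightarrow>
     (\<forall>X. is_instance \<tau> X \<longrightarrow>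
        (satisfiable_in X A \<longrightarrow> BLP_Affine_accepts A X) \<and>
        (\<not> satisfiable_in X B \<longrightarrow> BLP_Affine_rejects A X))"

end

theory Submission
  imports Defs
begin

text \<open>
  Scale a relative interior point of the LP by a common denominator \<open>\<ell>\<close> to integers \<open>(W, P)\<close>,
  and let \<open>(r, q)\<close> be a solution of the refined affine system. For a block of size
  \<open>b = u \<ell> + v\<close> with \<open>v < \<ell>\<close>, the integers \<open>u W + v r\<close> and \<open>u P + v q\<close> satisfy the marginal
  equalities with total \<open>b\<close>, and they are nonnegative once \<open>u\<close> is large, because \<open>r\<close> and \<open>q\<close>
  vanish wherever \<open>W\<close> and \<open>P\<close> do. Hence they can be realised as value counts on the block: for
  every constraint pick one tuple of the relation per coordinate with these counts. Each
  column then has, on every block, the value counts prescribed by its variable alone, so a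
  block-symmetric polymorphism with large blocks maps it to a value depending only on the
  variable, and this is a satisfying assignment in \<open>B\<close>.
\<close>

section \<open>Block symmetry and width\<close>

lemma count_image_mset_set:
  assumes "finite I"
  shows "count (image_mset f (mset_set I)) k = card {i\<in>I. f i = k}"
proof -
  have "count (image_mset f (mset_set I)) k = (\<Sum>i\<in>f -` {k} \<inter> I. 1)"
    using assms by (simp add: count_image_mset)
  also have "f -` {k} \<inter> I = {i\<in>I. f i = k}"
    by auto
  finally show ?thesis
    by simp
qed

lemma partition_on_block:
  assumes "partition_on I P"
  obtains b where "\<And>i. i \<in> I \<Longrightarrow> b i \<in> P" "\<And>i. i \<in> I \<Longrightarrow> i \<in> b i"
    "\<And>i D. D \<in> P \<Longrightarrow> i \<in> D \<Longrightarrow> b i = D"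
proof -
  have "\<exists>D. D \<in> P \<and> i \<in> D" if "i \<in> I" for i
    using that partition_onD1[OF assms] by blast
  then obtain b where b: "\<And>i. i \<in> I \<Longrightarrow> b i \<in> P \<and> i \<in> b i"
    by metis
  have b': "b i = D" if "D \<in> P" "i \<in> D" for i D
  proof -
    have "i \<in> I"
      using that partition_onD1[OF assms] by blast
    then show ?thesis
      using b[of i] that disjointD[OF partition_onD2[OF assms], of "b i" D] by blast
  qed
  show thesis
    by (rule that[of b]) (simp_all add: b b')
qed

text \<open>Tagging every coordinate with its block turns equal counts on all blocks into equality
  of a single multiset of pairs (block, value). Equal multisets are related by a permutation of the
  coordinates, and since it respects the tags it preserves each block.\<close>

lemma block_symmetric_eqI:
  assumes "block_symmetric S L f P" "partition_on {..<L} P"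
    and xs: "xs \<in> tuples L S" and ys: "ys \<in> tuples L S"
    and counts: "\<And>D a. D \<in> P \<Longrightarrow> a \<in> S \<Longrightarrow> card {l\<in>D. xs ! l = a} = card {l\<in>D. ys ! l = a}"
  shows "f xs = f ys"
proof -
  obtain b where b: "\<And>i. i < L \<Longrightarrow> b i \<in> P" "\<And>i. i < L \<Longrightarrow> i \<in> b i"
    "\<And>i D. D \<in> P \<Longrightarrow> i \<in> D \<Longrightarrow> b i = D"
    using partition_on_block[OF assms(2), unfolded lessThan_iff] by blast
  have sub: "D \<subseteq> {..<L}" if "D \<in> P" for D
    using that partition_onD1[OF assms(2)] by blast
  \<comment> \<open>The multiset comparison ranges over arbitrary pairs, while \<open>counts\<close>
    speaks only of blocks in \<open>P\<close> and values in \<open>S\<close>. All other pairs have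
    an empty fibre.\<close>
  have fibre: "{l\<in>{..<L}. (b l, zs ! l) = (D, a)} =
      (if D \<in> P \<and> a \<in> S then {l\<in>D. zs ! l = a} else {})"
    if "zs \<in> tuples L S" for zs :: "'a list" and D a
  proof -
    have "zs ! l \<in> S" if "l < L" for l
      using that \<open>zs \<in> tuples L S\<close> by (auto simp: tuples_def)
    then show ?thesis
      using b sub by (auto dest: subsetD[OF sub])
  qed
  have "image_mset (\<lambda>l. (b l, ys ! l)) (mset_set {..<L}) =
      image_mset (\<lambda>l. (b l, xs ! l)) (mset_set {..<L})"
  proof (rule multiset_eqI)
    fix k :: "nat set \<times> 'a"
    obtain D a where k: "k = (D, a)"
      by force
    show "count (image_mset (\<lambda>l. (b l, ys ! l)) (mset_set {..<L})) k =
        count (image_mset (\<lambda>l. (b l, xs ! l)) (mset_set {..<L})) k"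
      unfolding k count_image_mset_set[OF finite_lessThan] fibre[OF xs] fibre[OF ys]
      using counts by simp
  qed
  then obtain \<pi> where \<pi>: "\<pi> permutes {..<L}" "\<forall>l\<in>{..<L}. (b l, ys ! l) = (b (\<pi> l), xs ! \<pi> l)"
    by (rule image_mset_eq_implies_permutes[OF finite_lessThan])
  \<comment> \<open>Preservation of tags gives only an inclusion; finiteness of the block and
    injectivity of \<open>\<pi>\<close> turn it into the equality that
    \<open>block_symmetric\<close> asks for.\<close>
  have "\<pi> ` D = D" if "D \<in> P" for D
  proof (rule endo_inj_surj)
    show "finite D"
      using sub[OF that] finite_subset by blast
    show "\<pi> ` D \<subseteq> D"
    proof
      fix m assume "m \<in> \<pi> ` D"
      then obtain l where l: "l \<in> D" "m = \<pi> l"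
        by blast
      then have "l < L"
        using sub that by blast
      then have "m < L" "b m = b l"
        using \<pi> l permutes_in_image[OF \<pi>(1), of l] by auto
      then show "m \<in> D"
        using b l that by metis
    qed
    show "inj_on \<pi> D"
      using \<pi>(1) permutes_inj_on by blast
  qed
  then have "f (permute_list \<pi> xs) = f xs"
    using assms(1) \<pi>(1) xs by (simp add: block_symmetric_def)
  moreover have "permute_list \<pi> xs = ys"
    using \<pi> xs ys by (auto simp: permute_list_def tuples_def intro!: nth_equalityI)
  ultimately show ?thesis
    by simp
qed

text \<open>The maximum in \<open>width\<close> is attained, since there are finitely many
  partitions and at least one is admissible. A single partition therefore has all its blocks
  large.\<close>

lemma width_geE:
  assumes "0 < L" "N \<le> width S L f"
  obtains P where "partition_on {..<L} P" "block_symmetric S L f P"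
    "\<And>D. D \<in> P \<Longrightarrow> N \<le> card D"
proof -
  let ?Q = "{P. partition_on {..<L} P \<and> block_symmetric S L f P}"
  let ?m = "\<lambda>P. Min (card ` P)"
  have "?Q \<subseteq> Pow (Pow {..<L})"
    by (auto simp: partition_on_def)
  then have "finite ?Q"
    by (rule finite_subset) simp
  \<comment> \<open>A permutation fixing every singleton fixes every coordinate, so the discrete
    partition is admissible for any \<open>f\<close>.\<close>
  moreover have "(\<lambda>l. {l}) ` {..<L} \<in> ?Q"
  proof -
    have "permute_list \<pi> xs = xs"
      if "\<forall>D\<in>(\<lambda>l. {l}) ` {..<L}. \<pi> ` D = D" "xs \<in> tuples L S" for \<pi> and xs :: "'a list"
      using that by (auto simp: permute_list_def tuples_def intro!: nth_equalityI)
    then show ?thesis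
      by (auto simp: block_symmetric_def partition_on_def disjoint_def)
  qed
  ultimately have "Max (?m ` ?Q) \<in> ?m ` ?Q"
    by (intro Max_in) auto
  then obtain P where P: "P \<in> ?Q" "width S L f = ?m P"
    by (auto simp: width_def)
  have "finite P"
    using P(1) finite_elements[of "{..<L}" P] by simp
  then have "N \<le> card D" if "D \<in> P" for D
    using that P(2) assms(2) by (simp add: order_trans[OF _ Min_le])
  then show thesis
    using that P(1) by blast
qed

section \<open>Realising prescribed value counts\<close>

text \<open>Induction on \<open>S\<close>: a subset \<open>T\<close> of size \<open>c s\<close> is
  cut off from \<open>D\<close> and sent to \<open>s\<close>, and what remains has exactly the size
  required for the other values.\<close>

lemma ex_fun_with_counts:
  assumes "finite S" "finite D" "(\<Sum>s\<in>S. c s) = card D"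
  shows "\<exists>g\<in>D \<rightarrow> S. \<forall>s\<in>S. card {d\<in>D. g d = s} = c s"
  using assms
proof (induction S arbitrary: D rule: finite_induct)
  case empty
  then show ?case by auto
next
  case (insert s S)
  then have "c s \<le> card D"
    by simp
  then obtain T where T: "T \<subseteq> D" "card T = c s"
    by (metis obtain_subset_with_card_n)
  have "(\<Sum>s\<in>S. c s) = card (D - T)"
    using insert T by (simp add: card_Diff_subset finite_subset)
  then obtain g where g: "g \<in> D - T \<rightarrow> S" "\<And>t. t \<in> S \<Longrightarrow> card {d\<in>D - T. g d = t} = c t"
    using insert.IH[of "D - T"] insert.prems by auto
  let ?h = "\<lambda>d. if d \<in> T then s else g d"
  \<comment> \<open>Outside \<open>T\<close> the function takes values in \<open>S\<close>, which
    does not contain the new element \<open>s\<close>.\<close>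
  have "{d\<in>D. ?h d = s} = T"
    using T g(1) insert.hyps by auto
  moreover have "{d\<in>D. ?h d = t} = {d\<in>D - T. g d = t}" if "t \<in> S" for t
    using that insert.hyps by auto
  ultimately have "\<forall>t\<in>insert s S. card {d\<in>D. ?h d = t} = c t"
    using T g by simp
  moreover have "?h \<in> D \<rightarrow> insert s S"
    using g(1) by (auto simp: Pi_iff)
  ultimately show ?case
    by (intro bexI[of _ ?h])
qed

text \<open>Blocks are disjoint and cover \<open>I\<close>, so functions chosen separately on the
  blocks glue along the block \<open>b i\<close> of each point.\<close>

lemma ex_fun_with_block_counts:
  assumes "finite S" "finite I" "partition_on I P"
    and "\<And>D. D \<in> P \<Longrightarrow> (\<Sum>s\<in>S. c D s) = card D"
  shows "\<exists>g\<in>I \<rightarrow> S. \<forall>D\<in>P. \<forall>s\<in>S. card {i\<in>D. g i = s} = c D s"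
proof -
  obtain b where b: "\<And>i. i \<in> I \<Longrightarrow> b i \<in> P" "\<And>i. i \<in> I \<Longrightarrow> i \<in> b i"
    "\<And>i D. D \<in> P \<Longrightarrow> i \<in> D \<Longrightarrow> b i = D"
    using partition_on_block[OF assms(3)] by blast
  have "\<exists>g\<in>D \<rightarrow> S. \<forall>s\<in>S. card {d\<in>D. g d = s} = c D s" if "D \<in> P" for D
  proof (rule ex_fun_with_counts)
    show "finite D"
      using that assms(2) partition_onD1[OF assms(3)] by (auto intro: finite_subset)
  qed (use assms that in auto)
  then have "\<forall>D. \<exists>g. D \<in> P \<longrightarrow> g \<in> D \<rightarrow> S \<and> (\<forall>s\<in>S. card {d\<in>D. g d = s} = c D s)"
    by blast
  from choice[OF this] obtain G where
    "\<forall>D. D \<in> P \<longrightarrow> G D \<in> D \<rightarrow> S \<and> (\<forall>s\<in>S. card {d\<in>D. G D d = s} = c D s)" ..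
  then have G: "\<And>D. D \<in> P \<Longrightarrow> G D \<in> D \<rightarrow> S"
    "\<And>D s. D \<in> P \<Longrightarrow> s \<in> S \<Longrightarrow> card {d\<in>D. G D d = s} = c D s"
    by simp_all
  have "{i\<in>D. G (b i) i = s} = {d\<in>D. G D d = s}" if "D \<in> P" for D s
    using that b(3) by auto
  then have "\<forall>D\<in>P. \<forall>s\<in>S. card {i\<in>D. G (b i) i = s} = c D s"
    using G(2) by simp
  moreover have "(\<lambda>i. G (b i) i) \<in> I \<rightarrow> S"
    using b G(1) by blast
  ultimately show ?thesis
    by (intro bexI[of _ "\<lambda>i. G (b i) i"])
qed

section \<open>Marginal equalities with arbitrary total\<close>

text \<open>The homogenised form of \<open>relaxation_equalities\<close>. With the total as a
  parameter, solutions are closed under linear combinations; total 1 gives the two relaxations, and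
  total b describes value counts on a block of size b.\<close>

definition marginal_equalities ::
  "'r pcsp_instance \<Rightarrow> ('r, 'a) rel_structure \<Rightarrow> 'n::comm_ring_1 \<Rightarrow>
   (nat \<Rightarrow> 'a \<Rightarrow> 'n) \<Rightarrow> (nat \<Rightarrow> 'a list \<Rightarrow> 'n) \<Rightarrow> bool" where
  "marginal_equalities X A s w p \<longleftrightarrow>
     (\<forall>i<nvars X. (\<Sum>a\<in>domain A. w i a) = s) \<and>
     (\<forall>j<length (constraints X). case constraints X ! j of (R, xs) \<Rightarrow>
        (\<Sum>y\<in>relation A R. p j y) = s \<and>
        (\<forall>t<length xs. \<forall>a\<in>domain A. (\<Sum>y\<in>{y \<in> relation A R. y ! t = a}. p j y) = w (xs ! t) a))"

lemma marginal_equalities_constraint: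
  assumes "marginal_equalities X A s w p" "j < length (constraints X)" "constraints X ! j = (R, xs)"
  shows "(\<Sum>y\<in>relation A R. p j y) = s"
    and "t < length xs \<Longrightarrow> a \<in> domain A \<Longrightarrow>
      (\<Sum>y\<in>{y \<in> relation A R. y ! t = a}. p j y) = w (xs ! t) a"
proof -
  have "case constraints X ! j of (R, xs) \<Rightarrow> (\<Sum>y\<in>relation A R. p j y) = s \<and>
      (\<forall>t<length xs. \<forall>a\<in>domain A. (\<Sum>y\<in>{y \<in> relation A R. y ! t = a}. p j y) = w (xs ! t) a)"
    using assms(1)[unfolded marginal_equalities_def, THEN conjunct2, THEN spec, THEN mp, OF assms(2)] .
  then show "(\<Sum>y\<in>relation A R. p j y) = s"
    and "t < length xs \<Longrightarrow> a \<in> domain A \<Longrightarrow>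
      (\<Sum>y\<in>{y \<in> relation A R. y ! t = a}. p j y) = w (xs ! t) a"
    by (simp_all add: assms(3))
qed

lemma relaxation_equalities_iff:
  "relaxation_equalities X A w p \<longleftrightarrow> marginal_equalities X A 1 w p"
  by (simp add: relaxation_equalities_def marginal_equalities_def)

lemma marginal_equalities_linear:
  assumes "marginal_equalities X A s w p" "marginal_equalities X A s' w' p'"
  shows "marginal_equalities X A (c * s + d * s')
    (\<lambda>i a. c * w i a + d * w' i a) (\<lambda>j y. c * p j y + d * p' j y)"
  using assms unfolding marginal_equalities_def
  by (auto simp: sum.distrib sum_distrib_left[symmetric] split: prod.splits)

text \<open>Injectivity of \<open>of_int\<close>. It carries the scaled LP point, whose equalities
  are known over the rationals, to the integers, where it can be combined with the affine
  solution.\<close>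

lemma marginal_equalities_of_int:
  fixes w :: "nat \<Rightarrow> 'a \<Rightarrow> int"
  shows "marginal_equalities X A (of_int s :: 'n::{comm_ring_1,ring_char_0})
      (\<lambda>i a. of_int (w i a)) (\<lambda>j y. of_int (p j y)) \<longleftrightarrow> marginal_equalities X A s w p"
  unfolding marginal_equalities_def of_int_sum[symmetric] of_int_eq_iff ..

lemma instance_constraint:
  assumes "is_instance \<tau> X" "j < length (constraints X)" "constraints X ! j = (R, xs)"
  shows "R \<in> symbols \<tau>" "length xs = arity \<tau> R" "t < length xs \<Longrightarrow> xs ! t < nvars X"
proof -
  have "(R, xs) \<in> set (constraints X)"
    using assms by (metis nth_mem)
  then have "R \<in> symbols \<tau> \<and> xs \<in> tuples (arity \<tau> R) {..<nvars X}"
    using assms(1) by (auto simp: is_instance_def)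
  then show "R \<in> symbols \<tau>" "length xs = arity \<tau> R" "t < length xs \<Longrightarrow> xs ! t < nvars X"
    by (auto simp: tuples_def dest!: subsetD[OF _ nth_mem])
qed

text \<open>The equalities evaluate the weights only at variables, domain values and tuples of the
  constraint's relation. This allows scaled rational weights to be replaced by their floors, which
  are known to coincide with them only there.\<close>

lemma marginal_equalities_cong:
  assumes "is_instance \<tau> X"
    and w: "\<And>i a. i < nvars X \<Longrightarrow> a \<in> domain A \<Longrightarrow> w i a = w' i a"
    and p: "\<And>j y. j < length (constraints X) \<Longrightarrow> y \<in> relation A (fst (constraints X ! j)) \<Longrightarrow>
      p j y = p' j y"
    and "marginal_equalities X A s w p"
  shows "marginal_equalities X A s w' p'"
  unfolding marginal_equalities_def
proof (intro conjI allI impI, goal_cases)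
  case (1 i)
  then show ?case
    using assms(4) w by (simp add: marginal_equalities_def)
next
  case (2 j)
  obtain R xs where j: "constraints X ! j = (R, xs)"
    by force
  have p': "sum (p' j) T = sum (p j) T" if "T \<subseteq> relation A R" for T
    using that p 2 j by (intro sum.cong) auto
  have w': "w (xs ! t) a = w' (xs ! t) a" if "t < length xs" "a \<in> domain A" for t a
    using that w instance_constraint(3)[OF assms(1) 2 j] by simp
  from marginal_equalities_constraint[OF assms(4) 2 j] show ?case
    by (simp add: j p' w')
qed

lemma finite_relation:
  assumes "is_structure \<tau> A" "R \<in> symbols \<tau>"
  shows "finite (relation A R)"
proof -
  have "relation A R \<subseteq> {xs. set xs \<subseteq> domain A \<and> length xs = arity \<tau> R}"
    using assms by (auto simp: is_structure_def tuples_def)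
  then show ?thesis
    using assms finite_lists_length_eq finite_subset unfolding is_structure_def by blast
qed

section \<open>Relative interior points\<close>

lemma LP_feasible_midpoint:
  assumes "LP_feasible X A w p" "LP_feasible X A w' p'"
  shows "LP_feasible X A (\<lambda>i a. 1/2 * w i a + 1/2 * w' i a) (\<lambda>j y. 1/2 * p j y + 1/2 * p' j y)"
  using assms marginal_equalities_linear[of X A 1 w p 1 w' p' "1/2" "1/2"]
  unfolding LP_feasible_def relaxation_equalities_iff by auto

text \<open>A feasible point of maximal support will do: averaging it with another feasible point
  cannot enlarge the support.\<close>

lemma LP_relative_interior_exists:
  assumes "is_structure \<tau> A" "is_instance \<tau> X" "LP_feasible X A w0 p0"
  shows "\<exists>w p. LP_relative_interior X A w p"
proof -
  let ?R = "\<lambda>j. relation A (fst (constraints X ! j))"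
  \<comment> \<open>\<open>U\<close> indexes all LP coordinates at once, as a disjoint sum of
    variable weights and constraint weights, so that one finite support covers both.\<close>
  define U where "U = ({..<nvars X} \<times> domain A) <+> Sigma {..<length (constraints X)} ?R"
  define val :: "(nat \<Rightarrow> 'b \<Rightarrow> rat) \<times> (nat \<Rightarrow> 'b list \<Rightarrow> rat) \<Rightarrow> _ \<Rightarrow> rat"
    where "val = (\<lambda>(w, p). case_sum (\<lambda>(i, a). w i a) (\<lambda>(j, y). p j y))"
  define supp where "supp z = {u\<in>U. 0 < val z u}" for z
  define feas where "feas z = LP_feasible X A (fst z) (snd z)" for z
  have nonneg: "0 \<le> val z u" if "feas z" "u \<in> U" for z u
    using that by (auto simp: feas_def val_def U_def LP_feasible_def split: prod.splits sum.splits)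
  have "finite (?R j)" if "j < length (constraints X)" for j
    using finite_relation[OF assms(1)] instance_constraint(1)[OF assms(2) that]
    by (metis prod.collapse)
  then have "finite U"
    using assms(1) by (auto simp: U_def is_structure_def intro!: finite_Plus)
  have fin: "finite (supp z)" for z
    using \<open>finite U\<close> by (simp add: supp_def)
  have "card (supp z) \<le> card U" for z
    using \<open>finite U\<close> by (auto simp: supp_def intro: card_mono)
  moreover have "feas (w0, p0)"
    using assms(3) by (simp add: feas_def)
  ultimately have "\<exists>z. feas z \<and> (\<forall>z'. feas z' \<longrightarrow> card (supp z') \<le> card (supp z))"
    by (intro ex_has_greatest_nat[where b = "Suc (card U)"]) (simp_all add: less_Suc_eq_le)
  then obtain z where z: "feas z" and max: "\<And>z'. feas z' \<Longrightarrow> card (supp z') \<le> card (supp z)"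
    by blast
  have sub: "supp z' \<subseteq> supp z" if "feas z'" for z'
  proof -
    let ?m = "(\<lambda>i a. 1/2 * fst z i a + 1/2 * fst z' i a, \<lambda>j y. 1/2 * snd z j y + 1/2 * snd z' j y)"
    have "feas ?m"
      using LP_feasible_midpoint z that by (simp add: feas_def)
    have mid: "val ?m u = 1/2 * val z u + 1/2 * val z' u" for u
      by (auto simp: val_def split: prod.splits sum.splits)
    \<comment> \<open>Both values are nonnegative on \<open>U\<close>, so the midpoint is positive
      wherever either point is. Maximality of \<open>card (supp z)\<close> then forces
      \<open>supp z = supp ?m\<close>.\<close>
    have un: "supp z \<union> supp z' \<subseteq> supp ?m"
    proof
      fix u assume u: "u \<in> supp z \<union> supp z'"
      then have "u \<in> U"
        by (auto simp: supp_def)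
      then have "0 < val ?m u"
        using u nonneg[OF z, of u] nonneg[OF that, of u] unfolding mid by (auto simp: supp_def)
      then show "u \<in> supp ?m"
        using \<open>u \<in> U\<close> by (simp add: supp_def)
    qed
    then have "supp z = supp ?m"
      using max[OF \<open>feas ?m\<close>] fin by (intro card_seteq) auto
    then show ?thesis
      using un by blast
  qed
  have *: "0 < fst z i a" if "LP_feasible X A w' p'" "0 < w' i a" "i < nvars X" "a \<in> domain A"
    for w' p' i a
    using sub[of "(w', p')"] that
    by (auto simp: feas_def supp_def val_def U_def split: prod.splits dest!: subsetD[where c = "Inl (i, a)"])
  have **: "0 < snd z j y"
    if "LP_feasible X A w' p'" "0 < p' j y" "j < length (constraints X)" "y \<in> ?R j"
    for w' p' j y
    using sub[of "(w', p')"] that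
    by (auto simp: feas_def supp_def val_def U_def split: prod.splits dest!: subsetD[where c = "Inr (j, y)"])
  have "LP_relative_interior X A (fst z) (snd z)"
    unfolding LP_relative_interior_def using z * ** unfolding feas_def by blast
  then show ?thesis
    by blast
qed

section \<open>Completeness\<close>

text \<open>The number ring is left open, so that the same indicators serve as a rational point of
  the LP and as an integer solution of the affine system.\<close>

lemma indicator_relaxation_equalities:
  assumes "is_structure \<tau> A" "is_instance \<tau> X"
    and \<sigma>: "\<sigma> \<in> {..<nvars X} \<rightarrow> domain A"
      "\<forall>(R, xs)\<in>set (constraints X). map \<sigma> xs \<in> relation A R"
  shows "relaxation_equalities X A (\<lambda>i a. of_bool (\<sigma> i = a))
    (\<lambda>j y. of_bool (map \<sigma> (snd (constraints X ! j)) = y))"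
  unfolding relaxation_equalities_def
proof (intro conjI allI impI, goal_cases)
  case (1 i)
  then show ?case
    using \<sigma>(1) assms(1) by (auto simp: is_structure_def of_bool_def)
next
  case (2 j)
  obtain R xs where j: "constraints X ! j = (R, xs)"
    by force
  have "map \<sigma> xs \<in> relation A R"
    using \<sigma>(2) 2 j by (metis (mono_tags, lifting) case_prodD nth_mem)
  moreover have "finite (relation A R)"
    using finite_relation[OF assms(1) instance_constraint(1)[OF assms(2) 2 j]] .
  ultimately show ?case
    by (auto simp: j of_bool_def)
qed

lemma satisfiable_LP_feasible:
  assumes "is_structure \<tau> A" "is_instance \<tau> X" "satisfiable_in X A"
  shows "\<exists>w p. LP_feasible X A w p"
proof -
  obtain \<sigma> where "\<sigma> \<in> {..<nvars X} \<rightarrow> domain A"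
    "\<forall>(R, xs)\<in>set (constraints X). map \<sigma> xs \<in> relation A R"
    using assms(3) by (auto simp: satisfiable_in_def)
  from indicator_relaxation_equalities[OF assms(1,2) this] show ?thesis
    unfolding LP_feasible_def by (intro exI conjI) auto
qed

text \<open>The indicator point of a satisfying assignment is LP-feasible, so every relative
  interior point is positive on its support. Its integer copy therefore obeys the added zero
  constraints, whichever interior point was chosen.\<close>

lemma satisfiable_refined_Aff_solution:
  assumes "is_structure \<tau> A" "is_instance \<tau> X" "satisfiable_in X A"
    and "LP_relative_interior X A w p"
  shows "\<exists>r q. refined_Aff_solution X A w p r q"
proof -
  obtain \<sigma> where \<sigma>: "\<sigma> \<in> {..<nvars X} \<rightarrow> domain A"
    "\<forall>(R, xs)\<in>set (constraints X). map \<sigma> xs \<in> relation A R"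
    using assms(3) by (auto simp: satisfiable_in_def)
  note eqs = indicator_relaxation_equalities[OF assms(1,2) \<sigma>]
  let ?w = "\<lambda>i a. of_bool (\<sigma> i = a)"
    and ?p = "\<lambda>j y. of_bool (map \<sigma> (snd (constraints X ! j)) = y)"
  have feas: "LP_feasible X A ?w ?p"
    using eqs by (auto simp: LP_feasible_def)
  have "(?w i a :: int) = 0" if "i < nvars X" "a \<in> domain A" "w i a = 0" for i a
  proof (rule ccontr)
    assume "(?w i a :: int) \<noteq> 0"
    then have "(0 :: rat) < ?w i a"
      by (simp split: if_splits)
    then have "0 < w i a"
      using assms(4) feas that(1,2) unfolding LP_relative_interior_def by blast
    with that(3) show False by simp
  qed
  moreover have "(?p j y :: int) = 0"
    if "j < length (constraints X)" "y \<in> relation A (fst (constraints X ! j))" "p j y = 0" for j y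
  proof (rule ccontr)
    assume "(?p j y :: int) \<noteq> 0"
    then have "(0 :: rat) < ?p j y"
      by (simp split: if_splits)
    then have "0 < p j y"
      using assms(4) feas that(1,2) unfolding LP_relative_interior_def by blast
    with that(3) show False by simp
  qed
  ultimately have "refined_Aff_solution X A w p ?w ?p"
    using eqs unfolding refined_Aff_solution_def Aff_solution_def by blast
  then show ?thesis
    by blast
qed

section \<open>Soundness\<close>

lemma common_denominator:
  assumes "finite Q"
  shows "\<exists>d::nat. 0 < d \<and> (\<forall>x\<in>Q. \<exists>z::int. of_nat d * (x::rat) = of_int z)"
  using assms
proof (induction rule: finite_induct)
  case empty
  show ?case by auto
next
  case (insert x Q)
  then obtain d :: nat where d: "0 < d" "\<And>x. x \<in> Q \<Longrightarrow> \<exists>z::int. of_nat d * x = of_int z"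
    by blast
  obtain n m :: int where x: "x = of_int n / of_int m" "0 < m"
    by (metis quotient_of_div quotient_of_denom_pos surj_pair)
  have m: "(of_nat (nat m) :: rat) = of_int m"
    using x(2) by simp
  have "\<exists>z::int. of_nat (d * nat m) * y = of_int z" if "y \<in> insert x Q" for y
  proof (cases "y \<in> Q")
    case True
    then obtain z :: int where "of_nat d * y = of_int z"
      using d by blast
    then have "of_nat (d * nat m) * y = of_int (m * z)"
      unfolding of_nat_mult m by (simp add: algebra_simps)
    then show ?thesis by blast
  next
    case False
    with that have "of_nat (d * nat m) * y = of_int (int d * n)"
      unfolding of_nat_mult m using x by simp
    then show ?thesis by blast
  qed
  then show ?case
    using d(1) x(2) by (intro exI[of _ "d * nat m"]) auto
qed

text \<open>A nonzero \<open>W\<close> is at least 1, so \<open>u * W\<close> is at least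
  \<open>u\<close>, hence at least \<open>d * M\<close>, which bounds \<open>v * r\<close> in
  absolute value. If \<open>W\<close> is zero, both terms vanish.\<close>

lemma large_nonneg:
  fixes W r u v d M :: int
  assumes "0 \<le> W" "W = 0 \<Longrightarrow> r = 0" "\<bar>r\<bar> \<le> M" "0 \<le> v" "v \<le> d" "d * M \<le> u"
  shows "0 \<le> u * W + v * r"
proof (cases "W = 0")
  case False
  then have "1 \<le> W"
    using assms(1) by simp
  have "\<bar>v * r\<bar> \<le> d * M"
    using assms by (simp add: abs_mult mult_mono)
  moreover have "0 \<le> u"
    using assms by (smt (verit) mult_nonneg_nonneg)
  then have "u \<le> u * W"
    using \<open>1 \<le> W\<close> by (simp add: mult_le_cancel_left1)
  ultimately show ?thesis
    using assms(6) by linarith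
qed (use assms in simp)

text \<open>Division of \<open>b\<close> by the common denominator \<open>d\<close>: the multiple of
  \<open>d\<close> is supplied by the scaled LP point, of total \<open>d\<close>, and the remainder
  by the affine solution, of total 1. One threshold works for all coordinates because there are
  finitely many.\<close>

lemma refined_Aff_solution_block_weights:
  assumes "is_structure \<tau> A" "is_instance \<tau> X"
    and "LP_feasible X A w p" "refined_Aff_solution X A w p r q"
  obtains N where "\<And>b::nat. N \<le> b \<Longrightarrow> \<exists>w' p'. marginal_equalities X A (int b) w' p' \<and>
     (\<forall>i<nvars X. \<forall>a\<in>domain A. 0 \<le> w' i a) \<and>
     (\<forall>j<length (constraints X). \<forall>y\<in>relation A (fst (constraints X ! j)). 0 \<le> p' j y)"
proof -
  let ?R = "\<lambda>j. relation A (fst (constraints X ! j))"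
  define U where "U = {..<nvars X} \<times> domain A"
  define V where "V = Sigma {..<length (constraints X)} ?R"
  have "finite (?R j)" if "j < length (constraints X)" for j
    using finite_relation[OF assms(1)] instance_constraint(1)[OF assms(2) that]
    by (metis prod.collapse)
  then have fin: "finite U" "finite V"
    using assms(1) by (auto simp: U_def V_def is_structure_def)
  obtain d :: nat where d: "0 < d" and
    "\<forall>x\<in>(\<lambda>(i, a). w i a) ` U \<union> (\<lambda>(j, y). p j y) ` V. \<exists>z::int. of_nat d * x = of_int z"
    using common_denominator[of "(\<lambda>(i, a). w i a) ` U \<union> (\<lambda>(j, y). p j y) ` V"] fin by blast
  then have int: "(i, a) \<in> U \<Longrightarrow> \<exists>z::int. of_nat d * w i a = of_int z"
    "(j, y) \<in> V \<Longrightarrow> \<exists>z::int. of_nat d * p j y = of_int z" for i a j y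
    by force+
  \<comment> \<open>The floor merely names an integer: by the choice of \<open>d\<close> it is exact
    on \<open>U\<close>, and likewise for \<open>P\<close> on \<open>V\<close>.\<close>
  define W where "W i a = \<lfloor>of_nat d * w i a\<rfloor>" for i a
  define P where "P j y = \<lfloor>of_nat d * p j y\<rfloor>" for j y
  have W: "of_nat d * w i a = of_int (W i a)" if "(i, a) \<in> U" for i a
    using int(1)[OF that] by (auto simp: W_def)
  have P: "of_nat d * p j y = of_int (P j y)" if "(j, y) \<in> V" for j y
    using int(2)[OF that] by (auto simp: P_def)
  have "marginal_equalities X A 1 w p"
    using assms(3) by (simp add: LP_feasible_def relaxation_equalities_iff)
  \<comment> \<open>With second coefficient 0, the linear combination is plain scaling by
    \<open>d\<close>.\<close>
  from marginal_equalities_linear[OF this this, of "of_nat d" 0]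
  have "marginal_equalities X A (of_int (int d)) (\<lambda>i a. of_nat d * w i a) (\<lambda>j y. of_nat d * p j y)"
    by simp
  then have "marginal_equalities X A (of_int (int d) :: rat)
      (\<lambda>i a. of_int (W i a)) (\<lambda>j y. of_int (P j y))"
    by (rule marginal_equalities_cong[OF assms(2), rotated -1])
      (use W P in \<open>simp_all add: U_def V_def\<close>)
  then have WP: "marginal_equalities X A (int d) W P"
    unfolding marginal_equalities_of_int .
  have rq: "marginal_equalities X A 1 r q"
    using assms(4) by (simp add: refined_Aff_solution_def Aff_solution_def relaxation_equalities_iff)
  \<comment> \<open>Inserting 0 keeps the maximum defined when there are no coordinates, and makes
    \<open>M\<close> nonnegative.\<close>
  define M where "M = Max (insert 0 ((\<lambda>(i, a). \<bar>r i a\<bar>) ` U \<union> (\<lambda>(j, y). \<bar>q j y\<bar>) ` V))"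
  have M: "0 \<le> M" "\<And>i a. (i, a) \<in> U \<Longrightarrow> \<bar>r i a\<bar> \<le> M" "\<And>j y. (j, y) \<in> V \<Longrightarrow> \<bar>q j y\<bar> \<le> M"
    unfolding M_def using fin by (force intro!: Max_ge)+
  show thesis
  proof (rule that)
    fix b :: nat
    \<comment> \<open>This threshold makes the quotient \<open>b div d\<close> at least
      \<open>d * M\<close>, as \<open>large_nonneg\<close> requires for remainders up to
      \<open>d\<close>.\<close>
    assume b: "d * (d * nat M) \<le> b"
    define u v where "u = int (b div d)" and "v = int (b mod d)"
    have tot: "u * int d + v * 1 = int b"
      unfolding u_def v_def by (metis div_mult_mod_eq mult.right_neutral of_nat_add of_nat_mult)
    have "d * nat M \<le> b div d"
      using b d by (simp add: less_eq_div_iff_mult_less_eq mult.commute)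
    then have u: "int d * M \<le> u"
      using M(1) unfolding u_def by (metis of_nat_le_iff of_nat_mult int_nat_eq)
    have v: "0 \<le> v" "v \<le> int d"
      using d by (auto simp: v_def less_imp_le)
    have "0 \<le> u * W i a + v * r i a" if "i < nvars X" "a \<in> domain A" for i a
    proof (rule large_nonneg[OF _ _ _ v u])
      have ia: "(i, a) \<in> U" and "0 \<le> w i a"
        using that assms(3) by (auto simp: U_def LP_feasible_def)
      then have "(0::rat) \<le> of_int (W i a)"
        using W[OF ia] by (metis of_nat_0_le_iff mult_nonneg_nonneg)
      then show "0 \<le> W i a"
        by simp
      \<comment> \<open>Here the zero constraints of the refined system enter: positivity of
        \<open>d\<close> turns \<open>W i a = 0\<close> into \<open>w i a = 0\<close>. The same
        happens for \<open>q\<close> below.\<close>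
      show "r i a = 0" if "W i a = 0"
      proof -
        have "w i a = 0"
          using W[OF ia] d that by simp
        then show ?thesis
          using assms(4) \<open>i < nvars X\<close> \<open>a \<in> domain A\<close> by (simp add: refined_Aff_solution_def)
      qed
      show "\<bar>r i a\<bar> \<le> M"
        using M(2) ia .
    qed
    moreover have "0 \<le> u * P j y + v * q j y" if "j < length (constraints X)" "y \<in> ?R j" for j y
    proof (rule large_nonneg[OF _ _ _ v u])
      have jy: "(j, y) \<in> V" and "0 \<le> p j y"
        using that assms(3) by (auto simp: V_def LP_feasible_def)
      then have "(0::rat) \<le> of_int (P j y)"
        using P[OF jy] by (metis of_nat_0_le_iff mult_nonneg_nonneg)
      then show "0 \<le> P j y"
        by simp
      show "q j y = 0" if "P j y = 0"
      proof -
        have "p j y = 0"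
          using P[OF jy] d that by simp
        then show ?thesis
          using assms(4) \<open>j < length (constraints X)\<close> \<open>y \<in> ?R j\<close>
          by (simp add: refined_Aff_solution_def)
      qed
      show "\<bar>q j y\<bar> \<le> M"
        using M(3) jy .
    qed
    moreover have "marginal_equalities X A (int b)
        (\<lambda>i a. u * W i a + v * r i a) (\<lambda>j y. u * P j y + v * q j y)"
      using marginal_equalities_linear[OF WP rq, of u v] unfolding tot .
    ultimately show "\<exists>w' p'. marginal_equalities X A (int b) w' p' \<and>
        (\<forall>i<nvars X. \<forall>a\<in>domain A. 0 \<le> w' i a) \<and>
        (\<forall>j<length (constraints X). \<forall>y\<in>?R j. 0 \<le> p' j y)"
      by blast
  qed
qed

text \<open>Each variable \<open>i\<close> gets, independently of the constraints, a tuple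
  \<open>h i\<close> with the counts \<open>w D i\<close> on every block \<open>D\<close>, and is
  assigned \<open>f (h i)\<close>. For a constraint, rows \<open>Y l\<close> of the relation are
  chosen with counts \<open>p D j\<close>. Their columns need not equal the tuples \<open>h\<close>:
  the marginal equalities give equal counts on each block, and block symmetry does the rest.\<close>

lemma satisfiable_by_block_symmetric_polymorphism:
  assumes A: "is_structure \<tau> A" and X: "is_instance \<tau> X"
    and pol: "is_polymorphism \<tau> A B L f"
    and sym: "block_symmetric (domain A) L f P" and part: "partition_on {..<L} P"
    and eqs: "\<And>D. D \<in> P \<Longrightarrow> marginal_equalities X A (int (card D)) (w D) (p D)"
    and w: "\<And>D i a. D \<in> P \<Longrightarrow> i < nvars X \<Longrightarrow> a \<in> domain A \<Longrightarrow> 0 \<le> w D i a"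
    and p: "\<And>D j y. D \<in> P \<Longrightarrow> j < length (constraints X) \<Longrightarrow>
      y \<in> relation A (fst (constraints X ! j)) \<Longrightarrow> 0 \<le> p D j y"
  shows "satisfiable_in X B"
proof -
  have finA: "finite (domain A)"
    using A by (simp add: is_structure_def)
  have "\<exists>g\<in>{..<L} \<rightarrow> domain A. \<forall>D\<in>P. \<forall>a\<in>domain A. card {l\<in>D. g l = a} = nat (w D i a)"
    if i: "i < nvars X" for i
  proof (rule ex_fun_with_block_counts[OF finA finite_lessThan part])
    fix D assume D: "D \<in> P"
    have "int (\<Sum>a\<in>domain A. nat (w D i a)) = (\<Sum>a\<in>domain A. w D i a)"
      using w[OF D i] by simp
    also have "\<dots> = int (card D)"
      using eqs[OF D] i by (simp add: marginal_equalities_def)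
    finally show "(\<Sum>a\<in>domain A. nat (w D i a)) = card D"
      by linarith
  qed
  then have "\<forall>i. \<exists>g. i < nvars X \<longrightarrow> g \<in> {..<L} \<rightarrow> domain A \<and>
      (\<forall>D\<in>P. \<forall>a\<in>domain A. card {l\<in>D. g l = a} = nat (w D i a))"
    by blast
  from choice[OF this] obtain g where "\<forall>i<nvars X. g i \<in> {..<L} \<rightarrow> domain A \<and>
      (\<forall>D\<in>P. \<forall>a\<in>domain A. card {l\<in>D. g i l = a} = nat (w D i a))" ..
  then have g: "\<And>i. i < nvars X \<Longrightarrow> g i \<in> {..<L} \<rightarrow> domain A"
    "\<And>i D a. i < nvars X \<Longrightarrow> D \<in> P \<Longrightarrow> a \<in> domain A \<Longrightarrow> card {l\<in>D. g i l = a} = nat (w D i a)"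
    by simp_all
  define h where "h i = map (g i) [0..<L]" for i
  have h: "h i \<in> tuples L (domain A)" if "i < nvars X" for i
    using g(1)[OF that] by (auto simp: h_def tuples_def)
  have sub: "D \<subseteq> {..<L}" if "D \<in> P" for D
    using that partition_onD1[OF part] by blast
  have "map (\<lambda>i. f (h i)) xs \<in> relation B R" if c: "(R, xs) \<in> set (constraints X)" for R xs
  proof -
    obtain j where j: "j < length (constraints X)" "constraints X ! j = (R, xs)"
      using c by (auto simp: in_set_conv_nth)
    note R = instance_constraint[OF X j]
    have finR: "finite (relation A R)"
      using finite_relation[OF A R(1)] .
    have pos: "0 \<le> p D j y" if "D \<in> P" "y \<in> relation A R" for D y
      using p[OF that(1) j(1)] that(2) j(2) by simp
    have "\<exists>Y\<in>{..<L} \<rightarrow> relation A R. \<forall>D\<in>P. \<forall>y\<in>relation A R. card {l\<in>D. Y l = y} = nat (p D j y)"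
    proof (rule ex_fun_with_block_counts[OF finR finite_lessThan part])
      fix D assume D: "D \<in> P"
      have "int (\<Sum>y\<in>relation A R. nat (p D j y)) = (\<Sum>y\<in>relation A R. p D j y)"
        using pos[OF D] by simp
      also have "\<dots> = int (card D)"
        using marginal_equalities_constraint(1)[OF eqs[OF D] j] .
      finally show "(\<Sum>y\<in>relation A R. nat (p D j y)) = card D"
        by linarith
    qed
    then obtain Y where Y: "Y \<in> {..<L} \<rightarrow> relation A R"
      "\<And>D y. D \<in> P \<Longrightarrow> y \<in> relation A R \<Longrightarrow> card {l\<in>D. Y l = y} = nat (p D j y)"
      by blast
    have column: "f (map (\<lambda>l. Y l ! t) [0..<L]) = f (h (xs ! t))" if t: "t < length xs" for t
    proof (rule block_symmetric_eqI[OF sym part])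
      have "Y l ! t \<in> domain A" if "l < L" for l
      proof -
        have "Y l \<in> relation A R"
          using Y(1) that by blast
        then have "Y l \<in> tuples (arity \<tau> R) (domain A)"
          using A R(1) by (auto simp: is_structure_def)
        then show ?thesis
          using t R(2) by (auto simp: tuples_def)
      qed
      then show "map (\<lambda>l. Y l ! t) [0..<L] \<in> tuples L (domain A)"
        by (auto simp: tuples_def)
      show "h (xs ! t) \<in> tuples L (domain A)"
        using h R(3) t by blast
      fix D a assume D: "D \<in> P" and a: "a \<in> domain A"
      have "finite D"
        using sub[OF D] finite_subset by blast
      let ?S = "{y \<in> relation A R. y ! t = a}"
      \<comment> \<open>The rows with entry \<open>a\<close> at position \<open>t\<close> are sorted
        by the whole tuple they carry; summing the counts of these tuples yields the marginal, hence
        the weight of the variable at \<open>t\<close>.\<close>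
      have "{l\<in>D. map (\<lambda>l. Y l ! t) [0..<L] ! l = a} = (\<Union>y\<in>?S. {l\<in>D. Y l = y})"
        using sub[OF D] Y(1) by (auto simp: subset_iff Pi_iff)
      then have "card {l\<in>D. map (\<lambda>l. Y l ! t) [0..<L] ! l = a} = (\<Sum>y\<in>?S. card {l\<in>D. Y l = y})"
        using finR \<open>finite D\<close> by (simp add: card_UN_disjoint disjoint_iff)
      also have "\<dots> = (\<Sum>y\<in>?S. nat (p D j y))"
        using Y(2)[OF D] by simp
      also have "int \<dots> = (\<Sum>y\<in>?S. p D j y)"
        using pos[OF D] by simp
      also have "\<dots> = w D (xs ! t) a"
        using marginal_equalities_constraint(2)[OF eqs[OF D] j t a] .
      also have "\<dots> = int (card {l\<in>D. g (xs ! t) l = a})"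
        using g(2)[OF R(3)[OF t] D a] w[OF D R(3)[OF t] a] by simp
      also have "{l\<in>D. g (xs ! t) l = a} = {l\<in>D. h (xs ! t) ! l = a}"
        using sub[OF D] by (auto simp: h_def)
      finally show "card {l\<in>D. map (\<lambda>l. Y l ! t) [0..<L] ! l = a} = card {l\<in>D. h (xs ! t) ! l = a}"
        by simp
    qed
    have "map (\<lambda>t. f (map (\<lambda>l. Y l ! t) [0..<L])) [0..<arity \<tau> R] \<in> relation B R"
      using pol R(1) Y(1) by (simp add: is_polymorphism_def Pi_iff)
    also have "map (\<lambda>t. f (map (\<lambda>l. Y l ! t) [0..<L])) [0..<arity \<tau> R] = map (\<lambda>i. f (h i)) xs"
      using column R(2) by (auto intro: nth_equalityI)
    finally show ?thesis .
  qed
  moreover have "(\<lambda>i. f (h i)) \<in> {..<nvars X} \<rightarrow> domain B"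
    using pol h by (auto simp: is_polymorphism_def)
  ultimately show ?thesis
    unfolding satisfiable_in_def by blast
qed

text \<open>The threshold \<open>N\<close> depends on the instance and on both solutions, so it is
  fixed first and a polymorphism of width at least \<open>N\<close> is taken afterwards. Weights are
  chosen per block size, so blocks of equal size share them.\<close>

lemma refined_Aff_solution_satisfiable:
  assumes A: "is_structure \<tau> A" and X: "is_instance \<tau> X"
    and wide: "\<And>N :: nat. \<exists>(L, f)\<in>Pol \<tau> A B. N \<le> width (domain A) L f"
    and "LP_feasible X A w p" "refined_Aff_solution X A w p r q"
  shows "satisfiable_in X B"
proof -
  obtain N where "\<And>b::nat. N \<le> b \<Longrightarrow> \<exists>w' p'. marginal_equalities X A (int b) w' p' \<and>
     (\<forall>i<nvars X. \<forall>a\<in>domain A. 0 \<le> w' i a) \<and>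
     (\<forall>j<length (constraints X). \<forall>y\<in>relation A (fst (constraints X ! j)). 0 \<le> p' j y)"
    using refined_Aff_solution_block_weights[OF A X assms(4,5)] by blast
  then obtain w' p' where *: "\<And>b::nat. N \<le> b \<Longrightarrow> marginal_equalities X A (int b) (w' b) (p' b) \<and>
     (\<forall>i<nvars X. \<forall>a\<in>domain A. 0 \<le> w' b i a) \<and>
     (\<forall>j<length (constraints X). \<forall>y\<in>relation A (fst (constraints X ! j)). 0 \<le> p' b j y)"
    by metis
  obtain L f where f: "is_polymorphism \<tau> A B L f" "N \<le> width (domain A) L f"
    using wide[of N] by (auto simp: Pol_def)
  then have "0 < L"
    by (simp add: is_polymorphism_def)
  then obtain P where P: "partition_on {..<L} P" "block_symmetric (domain A) L f P"
    "\<And>D. D \<in> P \<Longrightarrow> N \<le> card D"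
    using width_geE f(2) by metis
  show ?thesis
    by (rule satisfiable_by_block_symmetric_polymorphism[OF A X f(1) P(2,1),
          where w = "\<lambda>D. w' (card D)" and p = "\<lambda>D. p' (card D)"])
      (use *[OF P(3)] in blast)+
qed

section \<open>Existence of a run and agreement of all runs on the verdict\<close>

theorem theorem4p1:
  fixes \<tau> :: "'r signature"
    and A :: "('r, 'a) rel_structure"
    and B :: "('r, 'b) rel_structure"
  assumes "promise_template \<tau> A B"
    and "\<And>N :: nat. \<exists>(L, f)\<in>Pol \<tau> A B. N \<le> width (domain A) L f"
  shows "BLP_Affine_solves_PCSP_Decision \<tau> A B"
  unfolding BLP_Affine_solves_PCSP_Decision_def
proof (intro allI impI conjI)
  fix X assume X: "is_instance \<tau> X"
  have A: "is_structure \<tau> A"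
    using assms(1) by (simp add: promise_template_def)
  {
    assume sat: "satisfiable_in X A"
    obtain w p where wp: "LP_relative_interior X A w p"
      using satisfiable_LP_feasible[OF A X sat] LP_relative_interior_exists[OF A X] by blast
    then obtain r q where "refined_Aff_solution X A w p r q"
      using satisfiable_refined_Aff_solution[OF A X sat] by blast
    with wp have "BLP_Affine_run A X Accept"
      by (rule BLP_Affine_run.accept)
    \<comment> \<open>Rejection in step 1 contradicts feasibility of the LP; rejection in step 3 is
      excluded for every relative interior point, not just for the one found above.\<close>
    moreover have "\<not> BLP_Affine_run A X Reject"
      using satisfiable_LP_feasible[OF A X sat] satisfiable_refined_Aff_solution[OF A X sat]
      by (auto elim: BLP_Affine_run.cases)
    ultimately have "BLP_Affine_run A X v \<longleftrightarrow> v = Accept" for v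
      by (cases v) simp_all
    then show "BLP_Affine_accepts A X"
      by (simp add: BLP_Affine_accepts_def)
  next
    assume "\<not> satisfiable_in X B"
    then have none: "\<not> refined_Aff_solution X A w p r q" if "LP_relative_interior X A w p" for w p r q
      using refined_Aff_solution_satisfiable[OF A X assms(2)] that
      by (auto simp: LP_relative_interior_def)
    \<comment> \<open>Either the LP is infeasible and step 1 rejects, or a relative interior point
      exists and \<open>none\<close> makes step 3 reject.\<close>
    have "BLP_Affine_run A X Reject"
      using LP_relative_interior_exists[OF A X] none BLP_Affine_run.intros(1,2) by metis
    moreover have "\<not> BLP_Affine_run A X Accept"
      using none by (auto elim: BLP_Affine_run.cases)
    ultimately have "BLP_Affine_run A X v \<longleftrightarrow> v = Reject" for v
      by (cases v) simp_all
    then show "BLP_Affine_rejects A X"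
      by (simp add: BLP_Affine_rejects_def)
  }
qed

end
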